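(* Let $\mu_1,\mu_2,\mu_3,\mu_4>0$ with $\mu_2=\mu_4$. Consider the central configurations $(\theta_1,\theta_2,\theta_3,\theta_4)$ of the planar $1+4$ body problem associated to the mass parameters $\mu_1,\mu_2,\mu_3,\mu_4$ that satisfy $\theta_1+\theta_2=\theta_3+\theta_4=\pi$. Then, for all values of these mass parameters, the number of such (classes of) central configurations is one, two or three. Moreover, the square $(\pi/2,\pi/2,\pi/2,\pi/2)$ is a central configuration associated to $\mu_1,\mu_2,\mu_3,\mu_4$ if and only if $\mu_3=\mu_1$, and the kite $(2\pi/3,\pi/3,\pi/3,2\pi/3)$ is a central configuration associated to $\mu_1,\mu_2,\mu_3,\mu_4$ if and only if $\mu_1=\mu_2$.
   Context: In the planar $1+4$ body problem, a massive body sits at the center of a circle and four satellites, with infinitesimal-mass parameters $\mu_1,\mu_2,\mu_3,\mu_4\in\mathbb{R}^+$ (positive reals), lie on the circle in cyclic order at distinct points. The coordinates are the angles between consecutive satellites: $\theta_i$ is the angle from satellite $i$ to satellite $i+1$ for $i=1,2,3$, and $\theta_4$ is the angle from satellite $4$ to satellite $1$. Thus $\theta_i>0$ for all $i$ and $\theta_1+\theta_2+\theta_3+\theta_4=2\pi$. Define $f:(0,2\pi)\to\mathbb{R}$ by $f(x)=\sin(x)\left(1-\frac{1}{8|\sin^3(x/2)|}\right)$. Definition: given $\mu_1,\dots,\mu_4>0$, a central configuration of the planar $1+4$ body problem associated to the mass parameters $\mu_1,\mu_2,\mu_3,\mu_4$ is a tuple $(\theta_1,\theta_2,\theta_3,\theta_4)$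 with all $\theta_i>0$ and $\theta_1+\theta_2+\theta_3+\theta_4=2\pi$ that satisfies $$\mu_2f(\theta_1)+\mu_3f(\theta_1+\theta_2)+\mu_4f(\theta_1+\theta_2+\theta_3)=0,$$ $$\mu_3f(\theta_2)+\mu_4f(\theta_2+\theta_3)+\mu_1f(\theta_2+\theta_3+\theta_4)=0,$$ $$\mu_4f(\theta_3)+\mu_1f(\theta_3+\theta_4)+\mu_2f(\theta_3+\theta_4+\theta_1)=0,$$ $$\mu_1f(\theta_4)+\mu_2f(\theta_4+\theta_1)+\mu_3f(\theta_4+\theta_1+\theta_2)=0.$$ Central configurations are considered modulo rotations and homotheties; each class is represented by exactly one tuple $(\theta_1,\theta_2,\theta_3,\theta_4)$, so counting classes means counting such tuples. *)

theory Defs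
  imports Complex_Main
begin

text \<open>The function is only ever used on the open interval from \<open>0\<close> to \<open>2 * pi\<close>: for a central
  configuration as defined below, every argument is a sum of at most three consecutive angles,
  so the junk values of division by zero play no role.\<close>

definition satellite_f :: "real \<Rightarrow> real" where
  "satellite_f x = sin x * (1 - 1 / (8 * \<bar>sin (x / 2) ^ 3\<bar>))"

text \<open>A configuration, modulo rotations and homotheties, is the tuple of the angles between
  consecutive satellites, the last one being the angle from the fourth satellite to the first.\<close>

definition central_configuration ::
  "real \<Rightarrow> real \<Rightarrow> real \<Rightarrow> real \<Rightarrow> real \<times> real \<times> real \<times> real \<Rightarrow> bool" where
  "central_configuration \<mu>1 \<mu>2 \<mu>3 \<mu>4 = (\<lambda>(\<theta>1, \<theta>2, \<theta>3, \<theta>4).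
     \<theta>1 > 0 \<and> \<theta>2 > 0 \<and> \<theta>3 > 0 \<and> \<theta>4 > 0 \<and> \<theta>1 + \<theta>2 + \<theta>3 + \<theta>4 = 2 * pi \<and>
     \<mu>2 * satellite_f \<theta>1 + \<mu>3 * satellite_f (\<theta>1 + \<theta>2) + \<mu>4 * satellite_f (\<theta>1 + \<theta>2 + \<theta>3) = 0 \<and>
     \<mu>3 * satellite_f \<theta>2 + \<mu>4 * satellite_f (\<theta>2 + \<theta>3) + \<mu>1 * satellite_f (\<theta>2 + \<theta>3 + \<theta>4) = 0 \<and>
     \<mu>4 * satellite_f \<theta>3 + \<mu>1 * satellite_f (\<theta>3 + \<theta>4) + \<mu>2 * satellite_f (\<theta>3 + \<theta>4 + \<theta>1) = 0 \<and>
     \<mu>1 * satellite_f \<theta>4 + \<mu>2 * satellite_f (\<theta>4 + \<theta>1) + \<mu>3 * satellite_f (\<theta>4 + \<theta>1 + \<theta>2) = 0)"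

end

theory Submission
  imports Defs
begin

text \<open>Monotonicity of \<open>f\<close> on \<open>(0, pi/2]\<close> together with \<open>f (pi - x) < f x\<close> for \<open>x > pi/2\<close>
  forces every configuration in question to be a kite \<open>(a, pi - a, pi - a, a)\<close>, and the four
  equations collapse to \<open>\<mu>1 f(a) - \<mu>3 f(pi - a) + \<mu>2 f(2a) = 0\<close>. After division by \<open>sin a / 8\<close>
  the left-hand side has positive third derivative on \<open>(0, pi)\<close>, so by Rolle's theorem it has at
  most three zeros; it is negative at \<open>pi/6\<close> and positive at \<open>5pi/6\<close>, so it has a zero.\<close>

section \<open>Symmetry and monotonicity of the function f\<close>

lemma satellite_f_pi [simp]: "satellite_f pi = 0"
  by (simp add: satellite_f_def)

lemma satellite_f_reflect: "satellite_f (2 * pi - x) = - satellite_f x"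
proof -
  have "sin ((2 * pi - x) / 2) = sin (x / 2)"
    by (simp add: diff_divide_distrib)
  moreover have "sin (2 * pi - x) = - sin x"
    by (simp add: sin_diff)
  ultimately show ?thesis
    by (simp add: satellite_f_def)
qed

text \<open>In this half-angle form f is a sine minus a quotient whose numerator decreases and whose
  denominator increases on (0, pi), so monotonicity can be read off.\<close>

lemma satellite_f_alt:
  assumes "0 < x" "x < 2 * pi"
  shows "satellite_f x = sin x - cos (x / 2) / (4 * sin (x / 2) ^ 2)"
proof -
  have s: "sin (x / 2) > 0"
    using assms by (intro sin_gt_zero) auto
  have "sin x = 2 * sin (x / 2) * cos (x / 2)"
    using sin_double[of "x / 2"] by simp
  then show ?thesis
    using s by (simp add: satellite_f_def abs_of_pos field_simps power2_eq_square power3_eq_cube)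
qed

lemma satellite_f_strict_mono:
  assumes "0 < x" "x < y" "y \<le> pi / 2"
  shows "satellite_f x < satellite_f y"
proof -
  have sx: "sin (x / 2) > 0" and cy: "cos (y / 2) > 0"
    using assms by (auto intro!: sin_gt_zero cos_gt_zero)
  have s: "sin (x / 2) ^ 2 < sin (y / 2) ^ 2"
    using sx assms by (intro power_strict_mono sin_monotone_2pi) auto
  have c: "cos (y / 2) < cos (x / 2)"
    using assms by (intro cos_monotone_0_pi) auto
  have "cos (y / 2) / (4 * sin (y / 2) ^ 2) < cos (x / 2) / (4 * sin (x / 2) ^ 2)"
    using s c sx cy by (intro frac_less) auto
  moreover have "sin x < sin y"
    using assms by (intro sin_monotone_2pi) auto
  ultimately show ?thesis
    using assms by (simp add: satellite_f_alt)
qed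

text \<open>The factor sin x is the same at x and pi - x, so only the second factors compete; beyond
  pi/2, sin(x/2) exceeds cos(x/2), hence less is subtracted at x.\<close>

lemma satellite_f_pi_minus_less:
  assumes "pi / 2 < x" "x < pi"
  shows "satellite_f (pi - x) < satellite_f x"
proof -
  have c: "sin ((pi - x) / 2) = cos (x / 2)"
    by (simp add: cos_sin_eq diff_divide_distrib)
  have c0: "cos (x / 2) > 0"
    using assms by (intro cos_gt_zero) auto
  have "cos (x / 2) < sin (x / 2)"
    unfolding c[symmetric] using assms by (intro sin_monotone_2pi) auto
  then have "cos (x / 2) ^ 3 < sin (x / 2) ^ 3"
    using c0 by (intro power_strict_mono) auto
  moreover from \<open>cos (x / 2) < sin (x / 2)\<close> c0 have s0: "sin (x / 2) > 0"
    by linarith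
  ultimately have "1 / (8 * sin (x / 2) ^ 3) < 1 / (8 * cos (x / 2) ^ 3)"
    using c0 by (intro divide_strict_left_mono) auto
  moreover have "sin x > 0"
    using assms by (intro sin_gt_zero) auto
  ultimately show ?thesis
    using c0 s0 by (simp add: satellite_f_def c)
qed

text \<open>f alone is not injective on (0, pi), so its values at a point and at the supplement are
  used together. If a < c, monotonicity rules out both points lying on the same side of pi/2, and
  then f(pi - c) < f(c) = f(a) < f(pi - a) = f(pi - c), which is absurd.\<close>

lemma satellite_f_inj_pair:
  assumes "0 < a" "a < pi" "0 < c" "c < pi"
    and f: "satellite_f a = satellite_f c" "satellite_f (pi - a) = satellite_f (pi - c)"
  shows "a = c"
proof -
  have no: False
    if "0 < a" "a < c" "c < pi"
      and f: "satellite_f a = satellite_f c" "satellite_f (pi - a) = satellite_f (pi - c)" for a c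
  proof -
    have c: "pi / 2 < c"
      using satellite_f_strict_mono[of a c] that by force
    have a: "a < pi / 2"
      using satellite_f_strict_mono[of "pi - c" "pi - a"] that by force
    have "satellite_f (pi - c) < satellite_f c"
      using satellite_f_pi_minus_less c that by simp
    moreover have "satellite_f a < satellite_f (pi - a)"
      using satellite_f_pi_minus_less[of "pi - a"] a that by simp
    moreover have "satellite_f a \<le> satellite_f (pi - c) \<or> satellite_f (pi - c) \<le> satellite_f a"
      by linarith
    ultimately show False
      using f satellite_f_strict_mono[of a "pi - c"] satellite_f_strict_mono[of "pi - c" a] a c that
      by linarith
  qed
  show ?thesis
    using no[of a c] no[of c a] assms by (cases a c rule: linorder_cases) auto
qed

section \<open>Reduction to kites\<close>

text \<open>Because f(pi) = 0 and f(2 pi - x) = - f(x), the first and third equations become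
  trivial, the fourth is the stated one, and the second is its negative.\<close>

lemma central_configuration_kite_iff:
  "central_configuration \<mu>1 \<mu>2 \<mu>3 \<mu>2 (a, pi - a, pi - a, a) \<longleftrightarrow>
     0 < a \<and> a < pi \<and> \<mu>1 * satellite_f a - \<mu>3 * satellite_f (pi - a) + \<mu>2 * satellite_f (2 * a) = 0"
proof -
  have "satellite_f (a + (pi - a)) = 0"
    "satellite_f (a + (pi - a) + (pi - a)) = - satellite_f a"
    "satellite_f (pi - a + (pi - a)) = - satellite_f (2 * a)"
    "satellite_f (pi - a + (pi - a) + a) = - satellite_f a"
    "satellite_f (pi - a + a) = 0"
    "satellite_f (pi - a + a + a) = - satellite_f (pi - a)"
    "satellite_f (a + a) = satellite_f (2 * a)"
    "satellite_f (a + a + (pi - a)) = - satellite_f (pi - a)"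
    using satellite_f_reflect[of a] satellite_f_reflect[of "2 * a"] satellite_f_reflect[of "pi - a"]
    by (simp_all add: algebra_simps)
  note e = this
  show ?thesis
    unfolding central_configuration_def prod.case e by (auto simp: algebra_simps)
qed

text \<open>Satellites 1 and 3 are opposite, so their mutual terms contain f(pi) = 0. After
  cancelling \<open>\<mu>2\<close>, the first and third equations say that f agrees at
  \<open>\<theta>1\<close>, \<open>\<theta>4\<close> and at their supplements
  \<open>\<theta>2\<close>, \<open>\<theta>3\<close>.\<close>

lemma central_configuration_imp_kite:
  assumes cc: "central_configuration \<mu>1 \<mu>2 \<mu>3 \<mu>2 (\<theta>1, \<theta>2, \<theta>3, \<theta>4)"
    and "\<mu>2 \<noteq> 0" and "\<theta>1 + \<theta>2 = pi" "\<theta>3 + \<theta>4 = pi"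
  shows "\<theta>2 = pi - \<theta>1 \<and> \<theta>3 = pi - \<theta>1 \<and> \<theta>4 = \<theta>1"
proof -
  have \<theta>: "\<theta>2 = pi - \<theta>1" "\<theta>3 = pi - \<theta>4"
    using assms by auto
  have e: "\<theta>1 + \<theta>2 + \<theta>3 = 2 * pi - \<theta>4" "\<theta>3 + \<theta>4 + \<theta>1 = 2 * pi - \<theta>2"
    using assms by auto
  have f: "satellite_f \<theta>1 = satellite_f \<theta>4" "satellite_f \<theta>2 = satellite_f \<theta>3"
    using cc assms(2-4) unfolding central_configuration_def prod.case e satellite_f_reflect
    by (auto simp: algebra_simps)
  have "0 < \<theta>1" "\<theta>1 < pi" "0 < \<theta>4" "\<theta>4 < pi"
    using cc \<theta> by (auto simp: central_configuration_def)
  then have "\<theta>1 = \<theta>4"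
    using f \<theta> satellite_f_inj_pair by blast
  then show ?thesis
    using \<theta> by simp
qed

section \<open>Counting zeros with Rolle's theorem\<close>

text \<open>One zero of the derivative is chosen in each gap between consecutive elements of
  \<open>S\<close>. \<open>S\<close> is any finite set of zeros, so finiteness of the full zero set
  need not be known, and the conclusion has the shape of the hypotheses, so the lemma can be
  iterated. For empty \<open>S\<close> the truncated difference is 0.\<close>

lemma Rolle_zeros:
  fixes h h' :: "real \<Rightarrow> real"
  assumes deriv: "\<And>x. a < x \<Longrightarrow> x < b \<Longrightarrow> (h has_real_derivative h' x) (at x)"
    and S: "finite S" "S \<subseteq> {a<..<b}" "\<And>x. x \<in> S \<Longrightarrow> h x = 0"
  obtains T where "finite T" "T \<subseteq> {a<..<b}" "\<And>x. x \<in> T \<Longrightarrow> h' x = 0" "card T = card S - 1"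
proof -
  define s where "s i = sorted_list_of_set S ! i" for i
  have s_in: "s i \<in> S" if "i < card S" for i
    using that S(1) unfolding s_def
    by (metis nth_mem set_sorted_list_of_set sorted_list_of_set.length_sorted_key_list_of_set)
  have s_less: "s i < s j" if "i < j" "j < card S" for i j
    using that strict_sorted_list_of_set[of S] unfolding s_def
    by (simp add: sorted_wrt_iff_nth_less)
  have "\<exists>z. s i < z \<and> z < s (Suc i) \<and> h' z = 0" if "Suc i < card S" for i
  proof -
    have lt: "s i < s (Suc i)" and in_S: "s i \<in> S" "s (Suc i) \<in> S"
      using s_less s_in that by auto
    have d: "(h has_real_derivative h' x) (at x)" if "s i \<le> x" "x \<le> s (Suc i)" for x
      using in_S S(2) that by (intro deriv) (force simp: subset_iff)+
    have "continuous_on {s i..s (Suc i)} h"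
      using d by (intro DERIV_continuous_on[of _ _ h']) (auto intro: has_field_derivative_at_within)
    moreover have "h (s i) = h (s (Suc i))"
      using S(3) in_S by simp
    \<comment> \<open>\<open>Rolle_deriv\<close> yields a vanishing linear map; evaluating it at 1
      gives h' z = 0.\<close>
    ultimately obtain z where "s i < z" "z < s (Suc i)" "(*) (h' z) = (\<lambda>v. 0)"
      using Rolle_deriv[OF lt, of h "\<lambda>x. (*) (h' x)"] d
      by (force simp: has_field_derivative_def)
    then show ?thesis
      by (metis mult.right_neutral)
  qed
  then obtain z where z: "\<And>i. Suc i < card S \<Longrightarrow> s i < z i \<and> z i < s (Suc i) \<and> h' (z i) = 0"
    by metis
  \<comment> \<open>The point \<open>s (Suc i)\<close> separates \<open>z i\<close> from every later
    \<open>z j\<close>, so the chosen zeros are distinct.\<close>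
  have z_less: "z i < z j" if "i < j" "Suc j < card S" for i j
  proof -
    have "z i < s (Suc i)" "s j < z j"
      using z that by auto
    moreover have "s (Suc i) \<le> s j"
      using s_less[of "Suc i" j] that by (cases "Suc i = j") auto
    ultimately show ?thesis
      by linarith
  qed
  have inj: "inj_on z {..<card S - 1}"
  proof (rule inj_onI)
    fix i j assume "i \<in> {..<card S - 1}" "j \<in> {..<card S - 1}" "z i = z j"
    then show "i = j"
      using z_less[of i j] z_less[of j i] by (cases i j rule: linorder_cases) (auto simp: less_diff_conv)
  qed
  show thesis
  proof
    show "z ` {..<card S - 1} \<subseteq> {a<..<b}"
    proof clarify
      fix i assume "i < card S - 1"
      then have i: "Suc i < card S"
        by simp
      then have "s i < z i" "z i < s (Suc i)" "s i \<in> {a<..<b}" "s (Suc i) \<in> {a<..<b}"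
        using z[OF i] s_in[of i] s_in[OF i] S(2) by (auto simp del: greaterThanLessThan_iff)
      then show "z i \<in> {a<..<b}"
        by auto
    qed
    show "card (z ` {..<card S - 1}) = card S - 1"
      using inj by (simp add: card_image)
  qed (use z in auto)
qed

text \<open>Each differentiation loses at most one zero, so four zeros of \<open>h\<close> would
  leave a zero of \<open>h3\<close>.\<close>

lemma card_zeros_le_3:
  fixes h h1 h2 h3 :: "real \<Rightarrow> real"
  assumes d1: "\<And>x. a < x \<Longrightarrow> x < b \<Longrightarrow> (h has_real_derivative h1 x) (at x)"
    and d2: "\<And>x. a < x \<Longrightarrow> x < b \<Longrightarrow> (h1 has_real_derivative h2 x) (at x)"
    and d3: "\<And>x. a < x \<Longrightarrow> x < b \<Longrightarrow> (h2 has_real_derivative h3 x) (at x)"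
    and nz: "\<And>x. a < x \<Longrightarrow> x < b \<Longrightarrow> h3 x \<noteq> 0"
  shows "finite {x. a < x \<and> x < b \<and> h x = 0} \<and> card {x. a < x \<and> x < b \<and> h x = 0} \<le> 3"
proof -
  have le: "card S \<le> 3" if S: "finite S" "S \<subseteq> {x. a < x \<and> x < b \<and> h x = 0}" for S
  proof -
    obtain T1 where T1: "finite T1" "T1 \<subseteq> {a<..<b}" "\<And>x. x \<in> T1 \<Longrightarrow> h1 x = 0"
        "card T1 = card S - 1"
      using Rolle_zeros[of a b h h1 S] d1 S by (auto simp: subset_iff)
    obtain T2 where T2: "finite T2" "T2 \<subseteq> {a<..<b}" "\<And>x. x \<in> T2 \<Longrightarrow> h2 x = 0"
        "card T2 = card T1 - 1"
      using Rolle_zeros[OF d2 T1(1-3)] by blast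
    obtain T3 where T3: "finite T3" "T3 \<subseteq> {a<..<b}" "\<And>x. x \<in> T3 \<Longrightarrow> h3 x = 0"
        "card T3 = card T2 - 1"
      using Rolle_zeros[OF d3 T2(1-3)] by blast
    have "T3 = {}"
      using T3(2,3) nz by fastforce
    then show ?thesis
      using T1(4) T2(4) T3(4) by simp
  qed
  then show ?thesis
    \<comment> \<open>An infinite zero set would contain a subset of size 4, against
      \<open>le\<close>.\<close>
    using infinite_arbitrarily_large[of "{x. a < x \<and> x < b \<and> h x = 0}" 4] by fastforce
qed

section \<open>The reduced function and its third derivative\<close>

definition cube_term :: "real \<Rightarrow> real" where
  "cube_term x = 8 - 1 / sin (x / 2) ^ 3"

text \<open>The left side of the kite equation divided by sin x / 8. The coefficient
  \<open>r\<close> will be twice the mass \<open>\<mu>2\<close>, because sin 2x = 2 sin x cos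
  x.\<close>

definition kite_fun :: "real \<Rightarrow> real \<Rightarrow> real \<Rightarrow> real \<Rightarrow> real" where
  "kite_fun p q r x =
     p * cube_term x - q * cube_term (pi - x) + r * (cos x * (8 - 1 / sin x ^ 3))"

lemma kite_fun_reflect: "kite_fun p q r (pi - x) = - kite_fun q p r x"
  by (simp add: kite_fun_def)

lemma satellite_f_kite_fun:
  assumes "0 < a" "a < pi"
  shows "p * satellite_f a - q * satellite_f (pi - a) + r * satellite_f (2 * a) =
    sin a / 8 * kite_fun p q (2 * r) a"
proof -
  have s: "sin (a / 2) > 0" "sin ((pi - a) / 2) > 0" "sin a > 0"
    using assms by (auto intro!: sin_gt_zero)
  then show ?thesis
    by (simp add: satellite_f_def kite_fun_def cube_term_def sin_double abs_of_pos
        del: sin_pi_minus) (simp add: field_simps)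
qed

text \<open>In these derivatives cos^2 is replaced by 1 - sin^2, so that the sign of the third one
  is visible.\<close>

definition cube_term1 :: "real \<Rightarrow> real" where
  "cube_term1 x = 3 / 2 * cos (x / 2) / sin (x / 2) ^ 4"

definition cube_term2 :: "real \<Rightarrow> real" where
  "cube_term2 x = 3 / 4 * (3 / sin (x / 2) ^ 3 - 4 / sin (x / 2) ^ 5)"

definition cube_term3 :: "real \<Rightarrow> real" where
  "cube_term3 x = 3 / 8 * cos (x / 2) * (20 / sin (x / 2) ^ 6 - 9 / sin (x / 2) ^ 4)"

lemma cube_term_derivs:
  assumes "0 < x" "x < pi"
  shows "(cube_term has_real_derivative cube_term1 x) (at x)"
    and "(cube_term1 has_real_derivative cube_term2 x) (at x)"
    and "(cube_term2 has_real_derivative cube_term3 x) (at x)"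
proof -
  have s: "sin (x / 2) \<noteq> 0"
    using sin_gt_zero[of "x / 2"] assms by simp
  have c: "cos (x / 2) * cos (x / 2) = 1 - sin (x / 2) * sin (x / 2)"
    using sin_cos_squared_add[of "x / 2"] by (simp add: power2_eq_square)
  have c': "cos (x / 2) * (cos (x / 2) * z) = (1 - sin (x / 2) * sin (x / 2)) * z" for z
    using c by (simp add: mult.assoc[symmetric])
  show "(cube_term has_real_derivative cube_term1 x) (at x)"
    unfolding cube_term_def cube_term1_def using s
    by (auto intro!: derivative_eq_intros simp: field_simps eval_nat_numeral)
  show "(cube_term1 has_real_derivative cube_term2 x) (at x)"
    unfolding cube_term2_def cube_term1_def using s
    by (auto intro!: derivative_eq_intros simp: field_simps eval_nat_numeral)
      (simp add: c c' algebra_simps)?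
  show "(cube_term2 has_real_derivative cube_term3 x) (at x)"
    unfolding cube_term2_def cube_term3_def using s
    by (auto intro!: derivative_eq_intros simp: field_simps eval_nat_numeral)
qed

text \<open>Since 0 < sin(x/2) <= 1, the term with the sixth power dominates.\<close>

lemma cube_term3_pos:
  assumes "0 < x" "x < pi"
  shows "cube_term3 x > 0"
proof -
  have s: "sin (x / 2) > 0" "cos (x / 2) > 0"
    using assms by (auto intro!: sin_gt_zero cos_gt_zero)
  have "sin (x / 2) ^ 6 \<le> sin (x / 2) ^ 4"
    using s by (intro power_decreasing) auto
  then have "9 / sin (x / 2) ^ 4 \<le> 9 / sin (x / 2) ^ 6"
    using s by (intro divide_left_mono) auto
  also have "\<dots> < 20 / sin (x / 2) ^ 6"
    using s by (intro divide_strict_right_mono) auto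
  finally have "20 / sin (x / 2) ^ 6 - 9 / sin (x / 2) ^ 4 > 0"
    by simp
  then show ?thesis
    using s by (simp add: cube_term3_def)
qed

lemma mixed_term_derivs:
  assumes "0 < x" "x < pi"
  shows "((\<lambda>x. cos x * (8 - 1 / sin x ^ 3)) has_real_derivative
      3 / sin x ^ 4 - 2 / sin x ^ 2 - 8 * sin x) (at x)"
    and "((\<lambda>x. 3 / sin x ^ 4 - 2 / sin x ^ 2 - 8 * sin x) has_real_derivative
      cos x * (4 / sin x ^ 3 - 12 / sin x ^ 5 - 8)) (at x)"
    and "((\<lambda>x. cos x * (4 / sin x ^ 3 - 12 / sin x ^ 5 - 8)) has_real_derivative
      60 / sin x ^ 6 - 60 / sin x ^ 4 + 8 / sin x ^ 2 + 8 * sin x) (at x)"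
proof -
  have s: "sin x \<noteq> 0"
    using sin_gt_zero[of x] assms by simp
  have c: "cos x * cos x = 1 - sin x * sin x"
    using sin_cos_squared_add[of x] by (simp add: power2_eq_square)
  \<comment> \<open>The same identity for right-nested products, where \<open>c\<close> alone does
    not match.\<close>
  have c': "cos x * (cos x * z) = (1 - sin x * sin x) * z" for z
    using c by (simp add: mult.assoc[symmetric])
  show "((\<lambda>x. cos x * (8 - 1 / sin x ^ 3)) has_real_derivative
      3 / sin x ^ 4 - 2 / sin x ^ 2 - 8 * sin x) (at x)"
    using s
    by (auto intro!: derivative_eq_intros simp: field_simps eval_nat_numeral)
      (simp add: c c' algebra_simps)?
  show "((\<lambda>x. 3 / sin x ^ 4 - 2 / sin x ^ 2 - 8 * sin x) has_real_derivative
      cos x * (4 / sin x ^ 3 - 12 / sin x ^ 5 - 8)) (at x)"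
    using s by (auto intro!: derivative_eq_intros simp: field_simps eval_nat_numeral)
  show "((\<lambda>x. cos x * (4 / sin x ^ 3 - 12 / sin x ^ 5 - 8)) has_real_derivative
      60 / sin x ^ 6 - 60 / sin x ^ 4 + 8 / sin x ^ 2 + 8 * sin x) (at x)"
    using s
    by (auto intro!: derivative_eq_intros simp: field_simps eval_nat_numeral)
      (simp add: c c' algebra_simps)?
qed

lemma mixed_term_third_pos:
  assumes "0 < x" "x < pi"
  shows "60 / sin x ^ 6 - 60 / sin x ^ 4 + 8 / sin x ^ 2 + 8 * sin x > 0"
proof -
  have s: "sin x > 0"
    using assms by (intro sin_gt_zero)
  have "sin x ^ 6 \<le> sin x ^ 4"
    using s by (intro power_decreasing) auto
  then have "60 / sin x ^ 4 \<le> 60 / sin x ^ 6"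
    using s by (intro divide_left_mono) auto
  moreover have "8 / sin x ^ 2 > 0"
    using s by simp
  ultimately show ?thesis
    using s by linarith
qed

text \<open>Each differentiation of \<open>cube_term (pi - x)\<close> contributes a factor -1, so at
  odd order the minus sign before \<open>q\<close> turns into plus. The third derivative is thus a
  positive combination of positive terms.\<close>

lemma card_zeros_kite_fun_le_3:
  assumes pos: "p > 0" "q > 0" "r > 0"
  defines "Z \<equiv> {x. 0 < x \<and> x < pi \<and> kite_fun p q r x = 0}"
  shows "finite Z \<and> card Z \<le> 3"
  unfolding Z_def
proof (rule card_zeros_le_3)
  fix x :: real assume x: "0 < x" "x < pi"
  have x': "0 < pi - x" "pi - x < pi"
    using x by auto
  \<comment> \<open>The chain rule for the reflection x to pi - x.\<close>
  note sub = DERIV_chain2[OF _ DERIV_diff[OF DERIV_const[of pi] DERIV_ident]]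
  note c = cube_term_derivs[OF x] and c' = cube_term_derivs[OF x', THEN sub]
    and m = mixed_term_derivs[OF x]
  show "(kite_fun p q r has_real_derivative
     p * cube_term1 x + q * cube_term1 (pi - x) + r * (3 / sin x ^ 4 - 2 / sin x ^ 2 - 8 * sin x))
       (at x)"
    unfolding kite_fun_def[abs_def]
    by (rule DERIV_cong[OF DERIV_add[OF DERIV_diff[OF DERIV_cmult[OF c(1)] DERIV_cmult[OF c'(1)]]
          DERIV_cmult[OF m(1)]]]) simp
  show "((\<lambda>x. p * cube_term1 x + q * cube_term1 (pi - x) +
        r * (3 / sin x ^ 4 - 2 / sin x ^ 2 - 8 * sin x))
      has_real_derivative
        p * cube_term2 x - q * cube_term2 (pi - x) +
        r * (cos x * (4 / sin x ^ 3 - 12 / sin x ^ 5 - 8))) (at x)"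
    by (rule DERIV_cong[OF DERIV_add[OF DERIV_add[OF DERIV_cmult[OF c(2)] DERIV_cmult[OF c'(2)]]
          DERIV_cmult[OF m(2)]]]) simp
  show "((\<lambda>x. p * cube_term2 x - q * cube_term2 (pi - x) +
        r * (cos x * (4 / sin x ^ 3 - 12 / sin x ^ 5 - 8)))
      has_real_derivative
        p * cube_term3 x + q * cube_term3 (pi - x) +
        r * (60 / sin x ^ 6 - 60 / sin x ^ 4 + 8 / sin x ^ 2 + 8 * sin x)) (at x)"
    by (rule DERIV_cong[OF DERIV_add[OF DERIV_diff[OF DERIV_cmult[OF c(3)] DERIV_cmult[OF c'(3)]]
          DERIV_cmult[OF m(3)]]]) simp
  show "p * cube_term3 x + q * cube_term3 (pi - x) +
      r * (60 / sin x ^ 6 - 60 / sin x ^ 4 + 8 / sin x ^ 2 + 8 * sin x) \<noteq> 0"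
    using pos cube_term3_pos[OF x] cube_term3_pos[OF x'] mixed_term_third_pos[OF x]
    by (smt (verit) mult_pos_pos)
qed

section \<open>Existence of a zero\<close>

text \<open>The point pi/6 is chosen because sin(pi/6) = 1/2 makes the \<open>r\<close> term vanish.
  \<open>cube_term\<close> changes sign at pi/3, which lies between pi/6 and 5pi/6.\<close>

lemma kite_fun_neg:
  assumes "p > 0" "q > 0"
  shows "kite_fun p q r (pi / 6) < 0"
proof -
  have s0: "sin (pi / 6 / 2) > 0"
    by (intro sin_gt_zero) auto
  have "sin (pi / 6 / 2) < sin (pi / 6)"
    by (intro sin_monotone_2pi) auto
  then have "sin (pi / 6 / 2) < 1 / 2"
    by (simp add: sin_30)
  then have "sin (pi / 6 / 2) ^ 3 < (1 / 2) ^ 3"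
    using s0 by (intro power_strict_mono) auto
  then have 1: "cube_term (pi / 6) < 0"
    using s0 by (simp add: cube_term_def field_simps)
  have "sin (pi / 6) < sin ((pi - pi / 6) / 2)"
    by (intro sin_monotone_2pi) auto
  then have l: "1 / 2 < sin ((pi - pi / 6) / 2)"
    by (simp add: sin_30)
  then have "(1 / 2) ^ 3 < sin ((pi - pi / 6) / 2) ^ 3"
    by (intro power_strict_mono) auto
  then have 2: "cube_term (pi - pi / 6) > 0"
    using l unfolding cube_term_def by (simp add: field_simps)
  have 3: "8 - 1 / sin (pi / 6) ^ 3 = 0"
    by (simp add: sin_30 power3_eq_cube)
  have "p * cube_term (pi / 6) < 0" "q * cube_term (pi - pi / 6) > 0"
    using 1 2 assms by (auto intro: mult_pos_neg)
  then show ?thesis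
    unfolding kite_fun_def 3 by linarith
qed

lemma kite_fun_zero_exists:
  assumes "p > 0" "q > 0"
  obtains x where "0 < x" "x < pi" "kite_fun p q r x = 0"
proof -
  have "kite_fun p q r (pi / 6) \<le> 0" "0 \<le> kite_fun p q r (pi - pi / 6)"
    \<comment> \<open>The second instance exchanges \<open>p\<close> and \<open>q\<close>;
      reflection turns it into positivity at 5pi/6.\<close>
    using kite_fun_neg[OF assms, of r] kite_fun_neg[OF assms(2,1), of r]
    by (simp_all only: kite_fun_reflect)
  moreover have "continuous_on {pi / 6..pi - pi / 6} (kite_fun p q r)"
  proof -
    have "sin (x / 2) > 0 \<and> sin ((pi - x) / 2) > 0 \<and> sin x > 0"
      if "pi / 6 \<le> x" "x \<le> pi - pi / 6" for x
    proof -
      have "0 < x" "x < pi"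
        using that pi_gt_zero by linarith+
      then show ?thesis
        by (auto intro!: sin_gt_zero)
    qed
    then show ?thesis
      unfolding kite_fun_def cube_term_def by (intro continuous_intros) force+
  qed
  ultimately obtain x where "pi / 6 \<le> x" "x \<le> pi - pi / 6" "kite_fun p q r x = 0"
    using IVT'[of "kite_fun p q r" "pi / 6" 0 "pi - pi / 6"] by auto
  then show thesis
    using that[of x] pi_gt_zero by linarith
qed

theorem theorem3:
  fixes \<mu>1 \<mu>2 \<mu>3 \<mu>4 :: real
  assumes "\<mu>1 > 0" and "\<mu>2 > 0" and "\<mu>3 > 0" and "\<mu>4 > 0" and "\<mu>2 = \<mu>4"
  shows "card {(\<theta>1, \<theta>2, \<theta>3, \<theta>4).
            central_configuration \<mu>1 \<mu>2 \<mu>3 \<mu>4 (\<theta>1, \<theta>2, \<theta>3, \<theta>4) \<and>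
            \<theta>1 + \<theta>2 = pi \<and> \<theta>3 + \<theta>4 = pi} \<in> {1, 2, 3}
    \<and> (central_configuration \<mu>1 \<mu>2 \<mu>3 \<mu>4 (pi / 2, pi / 2, pi / 2, pi / 2) \<longleftrightarrow> \<mu>3 = \<mu>1)
    \<and> (central_configuration \<mu>1 \<mu>2 \<mu>3 \<mu>4 (2 * pi / 3, pi / 3, pi / 3, 2 * pi / 3) \<longleftrightarrow> \<mu>1 = \<mu>2)"
proof (intro conjI)
  define Z where "Z = {x. 0 < x \<and> x < pi \<and> kite_fun \<mu>1 \<mu>3 (2 * \<mu>2) x = 0}"
  have kite: "central_configuration \<mu>1 \<mu>2 \<mu>3 \<mu>4 (a, pi - a, pi - a, a) \<longleftrightarrow> a \<in> Z" for a
    \<comment> \<open>On (0, pi) the factor sin a / 8 is nonzero, so both equations have the same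
      solutions.\<close>
    using sin_gt_zero[of a]
    by (auto simp: \<open>\<mu>2 = \<mu>4\<close>[symmetric] central_configuration_kite_iff satellite_f_kite_fun Z_def)
  have "{(\<theta>1, \<theta>2, \<theta>3, \<theta>4). central_configuration \<mu>1 \<mu>2 \<mu>3 \<mu>4 (\<theta>1, \<theta>2, \<theta>3, \<theta>4) \<and>
            \<theta>1 + \<theta>2 = pi \<and> \<theta>3 + \<theta>4 = pi} = (\<lambda>a. (a, pi - a, pi - a, a)) ` Z" (is "?C = ?g ` Z")
  proof (intro equalityI subsetI)
    fix t assume "t \<in> ?C"
    then obtain t1 t2 t3 t4 where t: "t = (t1, t2, t3, t4)"
      "central_configuration \<mu>1 \<mu>2 \<mu>3 \<mu>4 (t1, t2, t3, t4)" "t1 + t2 = pi" "t3 + t4 = pi"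
      by auto
    then have g: "t = ?g t1"
      using central_configuration_imp_kite[of \<mu>1 \<mu>2 \<mu>3 t1 t2 t3 t4] assms by auto
    then have "t1 \<in> Z"
      using t kite by metis
    then show "t \<in> ?g ` Z"
      using g by blast
  qed (use kite in auto)
  moreover have "inj_on ?g Z"
    by (auto intro: inj_onI)
  ultimately have "card ?C = card Z"
    by (simp add: card_image)
  moreover have Z: "finite Z" "card Z \<le> 3"
    using card_zeros_kite_fun_le_3[of \<mu>1 \<mu>3 "2 * \<mu>2"] assms by (auto simp: Z_def)
  moreover have "Z \<noteq> {}"
    using kite_fun_zero_exists[of \<mu>1 \<mu>3 "2 * \<mu>2"] assms by (auto simp: Z_def)
  \<comment> \<open>An infinite set has \<open>card\<close> 0, so finiteness matters here as well as
    nonemptiness.\<close>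
  then have "card Z > 0"
    using Z(1) by (simp add: card_gt_0_iff)
  ultimately show "card ?C \<in> {1, 2, 3}"
    by auto
next
  \<comment> \<open>The square is the kite with a = pi/2, where the equation reads
    (\<open>\<mu>1\<close> - \<open>\<mu>3\<close>) f(pi/2) = 0. Positivity follows from f(pi/3) = 0
    by monotonicity.\<close>
  have "satellite_f (pi / 2) > 0"
    using satellite_f_strict_mono[of "pi / 3" "pi / 2"]
    by (simp add: satellite_f_def sin_30 power3_eq_cube)
  then show "central_configuration \<mu>1 \<mu>2 \<mu>3 \<mu>4 (pi / 2, pi / 2, pi / 2, pi / 2) \<longleftrightarrow> \<mu>3 = \<mu>1"
    using central_configuration_kite_iff[of \<mu>1 \<mu>2 \<mu>3 "pi / 2"] \<open>\<mu>2 = \<mu>4\<close> by auto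
next
  \<comment> \<open>For a = 2pi/3 the \<open>\<mu>3\<close> term contains f(pi/3) = 0, and f(4pi/3)
    = - f(2pi/3) leaves (\<open>\<mu>1\<close> - \<open>\<mu>2\<close>) f(2pi/3) = 0.\<close>
  have p: "pi - 2 * pi / 3 = pi / 3"
    by simp
  have 0: "satellite_f (pi / 3) = 0"
    by (simp add: satellite_f_def sin_30 power3_eq_cube)
  have "satellite_f (2 * pi / 3) > 0"
    using satellite_f_pi_minus_less[of "2 * pi / 3"] 0 by (simp add: p)
  moreover have "satellite_f (2 * (2 * pi / 3)) = - satellite_f (2 * pi / 3)"
    using satellite_f_reflect[of "2 * pi / 3"] by (simp add: field_simps)
  ultimately show "central_configuration \<mu>1 \<mu>2 \<mu>3 \<mu>4 (2 * pi / 3, pi / 3, pi / 3, 2 * pi / 3) \<longleftrightarrow> \<mu>1 = \<mu>2"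
    using central_configuration_kite_iff[of \<mu>1 \<mu>2 \<mu>3 "2 * pi / 3"] 0 \<open>\<mu>2 = \<mu>4\<close>
    by (auto simp: p)
qed

end
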